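(* Let $n\ge 7$, let $\mathcal G$ be a connected bipartite cubic symmetric graph with $2n$ vertices, and let $\lambda_2$ be the second largest eigenvalue of its adjacency matrix $A$. Then the minimum distance $d$ of the code $\mathcal C(\mathcal G)$ satisfies $$ d\ \ge\ \begin{cases}\frac{2}{5}n, & \lambda_2\le 2,\\[2pt] \frac{2}{9}n, & 2<\lambda_2\le\sqrt 6,\\[2pt] 4, & \sqrt 6<\lambda_2<3.\end{cases}$$
   Context: All graphs are finite, without loops and multiple edges. A cubic symmetric graph is a $3$-regular graph that is arc-transitive, i.e. its automorphism group acts transitively on the set of arcs (ordered pairs of adjacent vertices). If $\mathcal G$ is a connected bipartite cubic symmetric graph with $2n$ vertices, order its vertices so that its adjacency matrix is $A=\begin{pmatrix}0&H\\H^T&0\end{pmatrix}$ with $H$ an $n\times n$ $(0,1)$-matrix. The code $\mathcal C(\mathcal G)$ is the binary linear code of length $n$ with parity-check matrix $H$, i.e. $\mathcal C(\mathcal G)=\{x\in\mathbb F_2^n : Hx^T=0\}$. The minimum distance of a code is the minimum Hamming distance between two distinct codewords; by convention the zero code of length $n$ has minimum distance $n$. *)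

theory Defs
  imports
    "Graph_Theory.Graph_Theory"
    "Jordan_Normal_Form.Char_Poly"
    "Jordan_Normal_Form.Matrix_Kernel"
    "HOL-Library.Z2"
begin

text \<open>
  A finite simple graph is a symmetric loop-free digraph whose arcs are ordered pairs of
  vertices (locale \<^locale>\<open>pair_graph\<close>), so that \<^const>\<open>parcs\<close> is the set of arcs in the sense of
  arc-transitivity.
\<close>

definition bipartite :: "'a pair_pre_digraph \<Rightarrow> bool" where
  "bipartite G \<longleftrightarrow> (\<exists>U W. U \<union> W = pverts G \<and> U \<inter> W = {} \<and>
     (\<forall>(u, v) \<in> parcs G. (u \<in> U \<and> v \<in> W) \<or> (u \<in> W \<and> v \<in> U)))"

definition cubic :: "'a pair_pre_digraph \<Rightarrow> bool" where
  "cubic G \<longleftrightarrow> (\<forall>v \<in> pverts G. out_degree (with_proj G) v = 3)"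

text \<open>
  An automorphism is an isomorphism whose image is the graph itself. The equation
  \<^prop>\<open>app_iso h (with_proj G) = with_proj G\<close> also forces the arc map of \<open>h\<close> to send \<open>(u, v)\<close> to the
  pair of images of \<open>u\<close> and \<open>v\<close> under the vertex map.
\<close>

definition automorphism ::
    "'a pair_pre_digraph \<Rightarrow> ('a, 'a \<times> 'a, 'a, 'a \<times> 'a) digraph_isomorphism \<Rightarrow> bool" where
  "automorphism G h \<longleftrightarrow>
     pre_digraph.digraph_isomorphism (with_proj G) h \<and> app_iso h (with_proj G) = with_proj G"

definition arc_transitive :: "'a pair_pre_digraph \<Rightarrow> bool" where
  "arc_transitive G \<longleftrightarrow>
     (\<forall>a \<in> parcs G. \<forall>b \<in> parcs G. \<exists>h. automorphism G h \<and> iso_arcs h a = b)"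

lemma automorphism_iso_arcs:
  assumes "automorphism G h" and "(u, v) \<in> parcs G"
  shows "iso_arcs h (u, v) = (iso_verts h u, iso_verts h v)"
proof -
  have "iso_tail h = fst" "iso_head h = snd"
    using assms(1) by (auto simp: automorphism_def app_iso_def with_proj_def)
  then show ?thesis
    using assms
    by (auto simp: automorphism_def pre_digraph.digraph_isomorphism_def with_proj_def prod_eq_iff)
qed

definition adjacency_matrix :: "'a pair_pre_digraph \<Rightarrow> 'a list \<Rightarrow> 'b :: zero_neq_one mat" where
  "adjacency_matrix G vs =
     mat (length vs) (length vs) (\<lambda>(i, j). if (vs ! i, vs ! j) \<in> parcs G then 1 else 0)"

text \<open>
  Eigenvalues are listed with multiplicity in decreasing order; the entry at position 1 is the
  second one. Meaningful for matrices with at least two real eigenvalues, in particular for real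
  symmetric matrices of dimension at least 2.
\<close>

definition second_largest_eigenvalue :: "real mat \<Rightarrow> real" where
  "second_largest_eigenvalue A = rev (sorted_list_of_multiset (proots (char_poly A))) ! 1"

definition parity_check_code :: "int mat \<Rightarrow> bit vec set" where
  "parity_check_code H = mat_kernel (map_mat of_int H)"

definition hamming_distance :: "'b vec \<Rightarrow> 'b vec \<Rightarrow> nat" where
  "hamming_distance x y = card {i. i < dim_vec x \<and> x $ i \<noteq> y $ i}"

text \<open>The code \<open>C\<close> is assumed to have length \<open>n\<close>; by convention the zero code has minimum distance \<open>n\<close>.\<close>

definition minimum_distance :: "nat \<Rightarrow> bit vec set \<Rightarrow> nat" where
  "minimum_distance n C =
     (if C = {0\<^sub>v n} then n
      else Min {hamming_distance x y | x y. x \<in> C \<and> y \<in> C \<and> x \<noteq> y})"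

end

theory Submission
  imports Defs "HOL-Analysis.Function_Topology"
begin

text \<open>
  Call the row indices of \<open>H\<close> checks and the column indices bits; they are the two colour classes
  \<open>R\<close> and \<open>C\<close> of the graph. The positions in which two codewords differ form a nonempty set
  \<open>S \<subseteq> C\<close> that every check meets in an even number of neighbours. As a check has only three
  neighbours, it meets \<open>S\<close> in none or in exactly two. Writing \<open>T\<close> for the set of checks that meet
  \<open>S\<close>, counting edges gives \<open>2 |T| = 3 |S|\<close>.

  If \<open>\<lambda>\<^sub>2\<close> is small, the graph expands and a small set cannot have its neighbours so concentrated.
  Precisely, for a set \<open>X\<close> in one class, the number of neighbours in \<open>X\<close>, as a function on the
  other class, has mean \<open>3 |X| / n\<close> and its variation about the mean is controlled by \<open>\<lambda>\<^sub>2\<close>;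
  with any \<open>c > 0\<close> above \<open>\<lambda>\<^sub>2\<close>, its square sum is at most
  \<open>c\<^sup>2 (|X| - |X|\<^sup>2 / n) + 9 |X|\<^sup>2 / n\<close> (lemma \<open>expander_mixing_bipartite\<close>). These are Tanner's
  two arguments:

  \<^item> For \<open>X = S\<close> the square sum is \<open>4 |T| = 6 |S|\<close>, and \<open>c = 2\<close> gives \<open>|S| \<ge> 2n/5\<close>.
  \<^item> For \<open>X = T\<close> every bit of \<open>S\<close> has all its three neighbours in \<open>T\<close>, so the square sum is at
    least \<open>9 |S|\<close> plus the number of edges from \<open>T\<close> to bits outside \<open>S\<close>, in total \<open>7 |T|\<close>;
    \<open>c = \<surd>6\<close> gives \<open>|T| \<ge> n/3\<close>, that is \<open>|S| \<ge> 2n/9\<close>.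

  The third bound is combinatorial. From \<open>2 |T| = 3 |S|\<close> the size of \<open>S\<close> is even, and if it were 2,
  the two bits would be twins, vertices with the same neighbours. Arc-transitivity spreads twins to
  all neighbours of a common neighbour, which forces the graph to be \<open>K\<^sub>3\<^sub>,\<^sub>3\<close>
  (lemma \<open>arc_transitive_cubic_no_twins\<close>).

  The spectral input is the Rayleigh bound \<open>f\<^sup>T A f \<le> \<lambda>\<^sub>2 f\<^sup>T f\<close> for functions \<open>f\<close> of sum zero. It does
  not require diagonalising \<open>A\<close>. By compactness the quadratic form attains a maximum \<open>m\<close> on the
  unit sphere of the sum-zero functions, the maximiser is an eigenfunction for \<open>m\<close>, and \<open>m < 3\<close> since
  the graph is connected. So \<open>m\<close> and 3 are distinct roots of the characteristic polynomial, and
  \<open>m\<close> is at most the second largest root.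
\<close>

section \<open>The Rayleigh quotient of a connected regular graph\<close>

text \<open>
  In the product topology on all functions, the unit sphere becomes compact once the values outside
  \<open>I\<close> are pinned to zero. Two points in \<open>I\<close> are needed for the sphere to be nonempty.
\<close>

lemma attains_max_on_centred_sphere:
  fixes F :: "('i \<Rightarrow> real) \<Rightarrow> real"
  assumes "finite I" and "2 \<le> card I" and "continuous_on UNIV F"
  obtains z where "sum z I = 0" and "(\<Sum>i\<in>I. (z i)\<^sup>2) = 1"
    and "\<And>y. sum y I = 0 \<Longrightarrow> (\<Sum>i\<in>I. (y i)\<^sup>2) = 1 \<Longrightarrow> (\<And>i. i \<notin> I \<Longrightarrow> y i = 0) \<Longrightarrow> F y \<le> F z"
proof -
  define B where "B = (\<lambda>i. if i \<in> I then {-1..1::real} else {0})"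
  define K where "K = PiE UNIV B \<inter> {y. sum y I = 0} \<inter> {y. (\<Sum>i\<in>I. (y i)\<^sup>2) = 1}"
  have "compact (PiE UNIV B)"
    using compactin_PiE[of "\<lambda>_. euclidean" UNIV B]
    by (simp add: B_def euclidean_product_topology)
  moreover have "closed {y :: 'i \<Rightarrow> real. sum y I = 0}"
    and "closed {y :: 'i \<Rightarrow> real. (\<Sum>i\<in>I. (y i)\<^sup>2) = 1}"
    by (intro closed_Collect_eq continuous_intros continuous_on_product_coordinates)+
  ultimately have "compact K"
    unfolding K_def by (intro compact_Int_closed)
  have memK: "y \<in> K" if "sum y I = 0" "(\<Sum>i\<in>I. (y i)\<^sup>2) = 1" "\<And>i. i \<notin> I \<Longrightarrow> y i = 0" for y
  proof -
    have "y i \<in> B i" for i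
    proof (cases "i \<in> I")
      case True
      then have "(y i)\<^sup>2 \<le> 1"
        using member_le_sum[of i I "\<lambda>i. (y i)\<^sup>2"] assms(1) that(2) by simp
      then show ?thesis
        using True by (simp add: B_def abs_square_le_1 abs_le_iff)
    qed (simp add: B_def that(3))
    then show ?thesis using that by (simp add: K_def PiE_iff)
  qed
  obtain a b where ab: "a \<in> I" "b \<in> I" "a \<noteq> b"
    using assms(1,2) by (metis card_le_Suc0_iff_eq not_less_eq_eq numeral_2_eq_2)
  define w where "w = (\<lambda>i. if i = a then sqrt (1/2) else if i = b then - sqrt (1/2) else 0)"
  have split: "sum f I = f a + (f b + sum f (I - {a} - {b}))" for f :: "'i \<Rightarrow> real"
    using ab assms(1) by (simp add: sum.remove[of I a] sum.remove[of "I - {a}" b])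
  have "w \<in> K"
    by (rule memK, unfold split) (use ab in \<open>auto simp: w_def\<close>)
  then obtain z where z: "z \<in> K" and max: "\<And>y. y \<in> K \<Longrightarrow> F y \<le> F z"
    using continuous_attains_sup[OF \<open>compact K\<close>, of F] continuous_on_subset[OF assms(3)] by blast
  show ?thesis
  proof (rule that[of z])
    show "sum z I = 0" "(\<Sum>i\<in>I. (z i)\<^sup>2) = 1" using z by (simp_all add: K_def)
  qed (rule max[OF memK])
qed

text \<open>
  Connectedness is stated as the absence of proper nonempty sets closed under taking neighbours,
  the form in which both the maximum principle and the twin argument use it. The adjacency
  operator maps \<open>f\<close> to the function \<open>u \<mapsto> sum f (E `` {u})\<close>.
\<close>

locale connected_regular_graph =
  fixes V :: "'a set" and E :: "('a \<times> 'a) set" and k :: nat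
  assumes finite_V: "finite V"
    and E_subset: "E \<subseteq> V \<times> V"
    and sym_E: "sym E"
    and regular: "v \<in> V \<Longrightarrow> card (E `` {v}) = k"
    and closed_eq_V: "S \<subseteq> V \<Longrightarrow> S \<noteq> {} \<Longrightarrow> E `` S \<subseteq> S \<Longrightarrow> S = V"
begin

lemma finite_nbrs: "finite (E `` {v})"
  by (rule finite_subset[OF _ finite_V]) (use E_subset in auto)

text \<open>
  Self-adjointness of the adjacency operator (for \<open>U = W = V\<close>), and the adjointness of its two
  blocks when \<open>U\<close> and \<open>W\<close> are the colour classes of a bipartite graph: both sides sum over the edges
  between \<open>U\<close> and \<open>W\<close>.
\<close>

lemma sum_nbrs_swap:
  fixes f g :: "'a \<Rightarrow> real"
  assumes "U \<subseteq> V" and "W \<subseteq> V" and "E `` U \<subseteq> W" and "E `` W \<subseteq> U"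
  shows "(\<Sum>u\<in>U. f u * sum g (E `` {u})) = (\<Sum>w\<in>W. g w * sum f (E `` {w}))"
proof -
  have fin: "finite U" "finite W" using assms(1,2) finite_V by (auto intro: finite_subset)
  have "(\<Sum>u\<in>U. f u * sum g (E `` {u})) = (\<Sum>u\<in>U. \<Sum>w\<in>{w \<in> W. (u, w) \<in> E}. f u * g w)"
    by (intro sum.cong refl) (use assms(3) in \<open>auto simp: sum_distrib_left intro!: sum.cong\<close>)
  also have "\<dots> = (\<Sum>w\<in>W. \<Sum>u\<in>{u \<in> U. (u, w) \<in> E}. f u * g w)"
    by (rule sum.swap_restrict[OF fin])
  also have "\<dots> = (\<Sum>w\<in>W. g w * sum f (E `` {w}))"
    by (intro sum.cong refl)
      (use assms(4) sym_E in \<open>auto simp: sum_distrib_left mult.commute intro!: sum.cong dest: symD\<close>)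
  finally show ?thesis .
qed

lemma sum_nbrs_regular:
  fixes f :: "'a \<Rightarrow> real"
  assumes "U \<subseteq> V" and "W \<subseteq> V" and "E `` U \<subseteq> W" and "E `` W \<subseteq> U"
  shows "(\<Sum>u\<in>U. sum f (E `` {u})) = k * sum f W"
  using sum_nbrs_swap[OF assms, of "\<lambda>_. 1" f] assms(2) regular
  by (auto simp: sum_distrib_left mult.commute intro!: sum.cong)

lemma sum_card_nbrs_Int:
  assumes "U \<subseteq> V" and "W \<subseteq> V" and "E `` U \<subseteq> W" and "E `` W \<subseteq> U" and "X \<subseteq> W"
  shows "(\<Sum>u\<in>U. real (card (E `` {u} \<inter> X))) = k * card X"
proof -
  have "finite W" using assms(2) finite_V by (rule finite_subset)
  then show ?thesis
    using sum_nbrs_regular[OF assms(1-4), of "\<lambda>w. of_bool (w \<in> X)"] finite_nbrs assms(5)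
    by (simp add: sum_of_bool_eq Int_absorb1)
qed

text \<open>
  The form \<open>m y\<^sup>T y - y\<^sup>T A y\<close> is nonnegative on the sum-zero functions and vanishes at \<open>z\<close>. Perturbing
  \<open>z\<close> in the direction of the residual \<open>A z - m z\<close>, which again has sum zero by regularity, changes it
  to first order by \<open>-2\<close> times the square norm of the residual, so the residual is zero.
\<close>

lemma maximizer_is_eigenfunction:
  fixes z :: "'a \<Rightarrow> real"
  assumes z0: "sum z V = 0"
    and z1: "(\<Sum>u\<in>V. z u * sum z (E `` {u})) = m * (\<Sum>u\<in>V. (z u)\<^sup>2)"
    and max: "\<And>y. sum y V = 0 \<Longrightarrow> (\<Sum>u\<in>V. y u * sum y (E `` {u})) \<le> m * (\<Sum>u\<in>V. (y u)\<^sup>2)"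
    and u: "u \<in> V"
  shows "sum z (E `` {u}) = m * z u"
proof -
  have EV: "E `` V \<subseteq> V" using E_subset by auto
  define y where "y u = sum z (E `` {u}) - m * z u" for u
  define a where "a = (\<Sum>u\<in>V. (y u)\<^sup>2)"
  define b where "b = m * (\<Sum>u\<in>V. (y u)\<^sup>2) - (\<Sum>u\<in>V. y u * sum y (E `` {u}))"
  have y0: "sum y V = 0"
    using sum_nbrs_regular[OF order.refl order.refl EV EV, of z] z0
    by (simp add: y_def sum_subtractf flip: sum_distrib_left)
  have a_eq: "(\<Sum>u\<in>V. y u * sum z (E `` {u})) - m * (\<Sum>u\<in>V. y u * z u) = a"
  proof -
    have "a = (\<Sum>u\<in>V. y u * (sum z (E `` {u}) - m * z u))"
      by (simp add: a_def power2_eq_square y_def)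
    then show ?thesis
      by (simp add: right_diff_distrib sum_subtractf sum_distrib_left[of m] mult.left_commute)
  qed
  have "0 \<le> a" by (simp add: a_def sum_nonneg)
  have "0 \<le> b" using max[OF y0] by (simp add: b_def)
  \<comment> \<open>the maximality of \<open>z\<close> against \<open>z + t y\<close>\<close>
  have ineq: "2 * t * a \<le> t\<^sup>2 * b" for t
  proof -
    have *: "sum (\<lambda>u. z u + t * y u) V = 0"
      using z0 y0 by (simp add: sum.distrib flip: sum_distrib_left)
    have "(\<Sum>u\<in>V. (z u + t * y u) * (\<Sum>v\<in>E `` {u}. z v + t * y v)) =
        (\<Sum>u\<in>V. z u * sum z (E `` {u})) + t * (\<Sum>u\<in>V. z u * sum y (E `` {u})) +
        t * (\<Sum>u\<in>V. y u * sum z (E `` {u})) + t\<^sup>2 * (\<Sum>u\<in>V. y u * sum y (E `` {u}))"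
      by (simp add: sum.distrib power2_eq_square algebra_simps flip: sum_distrib_left)
    moreover have "(\<Sum>u\<in>V. (z u + t * y u)\<^sup>2) =
        (\<Sum>u\<in>V. (z u)\<^sup>2) + 2 * t * (\<Sum>u\<in>V. y u * z u) + t\<^sup>2 * a"
      by (simp add: a_def power2_sum sum.distrib power_mult_distrib sum_distrib_left algebra_simps)
    moreover have "(\<Sum>u\<in>V. z u * sum y (E `` {u})) = (\<Sum>u\<in>V. y u * sum z (E `` {u}))"
      by (rule sum_nbrs_swap) (use EV in auto)
    ultimately show ?thesis
      using max[OF *] z1 a_eq unfolding b_def a_def[symmetric]
      by (simp add: algebra_simps)
  qed
  have "a = 0"
  proof (rule ccontr)
    assume "a \<noteq> 0"
    with \<open>0 \<le> a\<close> have "0 < a" by simp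
    \<comment> \<open>small enough for the linear term to win; the summand 1 avoids dividing by zero\<close>
    define t where "t = a / (b + 1)"
    have "0 < t" using \<open>0 < a\<close> \<open>0 \<le> b\<close> by (simp add: t_def)
    with ineq[of t] have "2 * a \<le> t * b" by (simp add: power2_eq_square)
    also have "\<dots> \<le> a" using \<open>0 < a\<close> \<open>0 \<le> b\<close> by (simp add: t_def field_simps)
    finally show False using \<open>0 < a\<close> by simp
  qed
  then have "y u = 0"
    using u finite_V by (simp add: a_def sum_nonneg_eq_0_iff)
  then show ?thesis by (simp add: y_def)
qed

text \<open>
  Maximum principle: at a vertex where \<open>z\<close> has its maximum, \<open>m \<ge> k\<close> would force all neighbours to
  have the maximal value too. By connectedness \<open>z\<close> would be a positive constant, against sum zero.
\<close>

lemma centred_eigenvalue_less_degree: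
  fixes z :: "'a \<Rightarrow> real"
  assumes z0: "sum z V = 0" and z1: "\<exists>u\<in>V. z u \<noteq> 0"
    and eig: "\<And>u. u \<in> V \<Longrightarrow> sum z (E `` {u}) = m * z u"
  shows "m < k"
proof (rule ccontr)
  assume "\<not> m < k"
  define M where "M = Max (z ` V)"
  define S where "S = {u \<in> V. z u = M}"
  have "V \<noteq> {}" using z1 by auto
  then have "M \<in> z ` V" unfolding M_def using finite_V by simp
  then have "S \<noteq> {}" by (auto simp: S_def)
  have le: "z u \<le> M" if "u \<in> V" for u
    using that finite_V by (simp add: M_def)
  have "0 < M"
  proof (rule ccontr)
    assume "\<not> 0 < M"
    then have "\<forall>u\<in>V. 0 \<le> - z u" using le by fastforce
    moreover have "(\<Sum>u\<in>V. - z u) = 0" using z0 by (simp add: sum_negf)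
    ultimately have "\<forall>u\<in>V. - z u = 0" using finite_V by (simp only: sum_nonneg_eq_0_iff)
    then show False using z1 by simp
  qed
  have "E `` S \<subseteq> S"
  proof safe
    fix u v assume "u \<in> S" and uv: "(u, v) \<in> E"
    then have u: "u \<in> V" "z u = M" by (auto simp: S_def)
    have nb: "w \<in> V" if "w \<in> E `` {u}" for w using that E_subset by auto
    have "(\<Sum>w\<in>E `` {u}. M - z w) = k * M - m * M"
      using eig[OF u(1)] regular[OF u(1)] u by (simp add: sum_subtractf)
    also have "\<dots> \<le> 0" using \<open>\<not> m < k\<close> \<open>0 < M\<close> by simp
    finally have "(\<Sum>w\<in>E `` {u}. M - z w) = 0"
      using le nb by (intro antisym sum_nonneg) auto
    then have "\<forall>w\<in>E `` {u}. M - z w = 0"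
      using le nb finite_nbrs by (subst (asm) sum_nonneg_eq_0_iff) auto
    then show "v \<in> S" using uv nb by (auto simp: S_def)
  qed
  then have "S = V" using \<open>S \<noteq> {}\<close> by (intro closed_eq_V) (auto simp: S_def)
  then have "\<forall>u\<in>V. z u = M" by (auto simp: S_def)
  then have "sum z V = card V * M" by simp
  then show False using z0 \<open>0 < M\<close> \<open>V \<noteq> {}\<close> finite_V by simp
qed

text \<open>
  By homogeneity, the maximum on the unit sphere dominates the Rayleigh quotient everywhere.
\<close>

lemma ex_centred_eigenfunction_dominating:
  assumes "2 \<le> card V"
  obtains m :: real and z :: "'a \<Rightarrow> real" where "m < k" and "\<exists>u\<in>V. z u \<noteq> 0"
    and "\<And>u. u \<in> V \<Longrightarrow> sum z (E `` {u}) = m * z u"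
    and "\<And>y. sum y V = 0 \<Longrightarrow> (\<Sum>u\<in>V. y u * sum y (E `` {u})) \<le> m * (\<Sum>u\<in>V. (y u)\<^sup>2)"
proof -
  define F where "F y = (\<Sum>u\<in>V. y u * sum y (E `` {u}))" for y :: "'a \<Rightarrow> real"
  have "continuous_on UNIV F"
    unfolding F_def by (intro continuous_intros continuous_on_product_coordinates)
  from attains_max_on_centred_sphere[OF finite_V assms this]
  obtain z where z: "sum z V = 0" "(\<Sum>u\<in>V. (z u)\<^sup>2) = 1"
    and max: "\<And>y. sum y V = 0 \<Longrightarrow> (\<Sum>u\<in>V. (y u)\<^sup>2) = 1 \<Longrightarrow> (\<And>i. i \<notin> V \<Longrightarrow> y i = 0) \<Longrightarrow> F y \<le> F z"
    by metis
  have max': "F y \<le> F z * (\<Sum>u\<in>V. (y u)\<^sup>2)" if y: "sum y V = 0" for y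
  proof (cases "(\<Sum>u\<in>V. (y u)\<^sup>2) = 0")
    case True
    then have "\<forall>u\<in>V. y u = 0" using finite_V by (simp add: sum_nonneg_eq_0_iff)
    then have "F y = 0" by (simp add: F_def)
    with True show ?thesis by simp
  next
    case False
    define s where "s = (\<Sum>u\<in>V. (y u)\<^sup>2)"
    have "0 < s" using False by (simp add: s_def sum_nonneg order_less_le)
    define w where "w u = (if u \<in> V then y u / sqrt s else 0)" for u
    have wE: "sum w (E `` {u}) = sum y (E `` {u}) / sqrt s" for u
      unfolding sum_divide_distrib by (rule sum.cong) (use E_subset in \<open>auto simp: w_def\<close>)
    have "F w = F y / s"
    proof -
      have "F w = (\<Sum>u\<in>V. y u / sqrt s * (sum y (E `` {u}) / sqrt s))"
        unfolding F_def wE by (rule sum.cong) (simp_all add: w_def)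
      then show ?thesis
        using \<open>0 < s\<close> by (simp add: F_def sum_divide_distrib[of _ _ s])
    qed
    moreover have "F w \<le> F z"
    proof (rule max)
      show "sum w V = 0" using y by (simp add: w_def flip: sum_divide_distrib)
      show "(\<Sum>u\<in>V. (w u)\<^sup>2) = 1"
        using \<open>0 < s\<close> by (simp add: w_def power_divide flip: sum_divide_distrib s_def)
    qed (simp add: w_def)
    ultimately show ?thesis using \<open>0 < s\<close> by (simp add: s_def[symmetric] pos_divide_le_eq mult.commute)
  qed
  have eig: "sum z (E `` {u}) = F z * z u" if "u \<in> V" for u
    by (rule maximizer_is_eigenfunction) (use z max' that in \<open>auto simp: F_def\<close>)
  have nz: "\<exists>u\<in>V. z u \<noteq> 0"
  proof (rule ccontr)
    assume "\<not> ?thesis"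
    then have "(\<Sum>u\<in>V. (z u)\<^sup>2) = 0" by simp
    then show False using z(2) by simp
  qed
  show ?thesis
    by (rule that[OF centred_eigenvalue_less_degree[OF z(1) nz eig] nz eig])
      (use max' in \<open>auto simp: F_def\<close>)
qed

end

section \<open>The Rayleigh bound by the second largest eigenvalue\<close>

lemma second_largest_entry_ge:
  fixes M :: "real multiset"
  assumes "a \<in># M" and "b \<in># M" and "a < b"
  shows "a \<le> rev (sorted_list_of_multiset M) ! 1"
proof (rule ccontr)
  define xs where "xs = rev (sorted_list_of_multiset M)"
  assume "\<not> ?thesis"
  then have lt: "xs ! 1 < a" by (simp add: xs_def)
  have "sorted (rev xs)" by (simp add: xs_def)
  \<comment> \<open>only the head of the list can reach \<open>a\<close>, but both \<open>a\<close> and \<open>b\<close> occur in it\<close>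
  have only_head: "i = 0" if "i < length xs" "a \<le> xs ! i" for i
  proof (rule ccontr)
    assume "i \<noteq> 0"
    then have "xs ! i \<le> xs ! 1"
      using sorted_rev_nth_mono[OF \<open>sorted (rev xs)\<close>, of 1 i] that by simp
    then show False using lt that by simp
  qed
  have "set xs = set_mset M" by (simp add: xs_def)
  then obtain i j where "i < length xs" "xs ! i = a" "j < length xs" "xs ! j = b"
    using assms by (metis in_set_conv_nth)
  then show False using only_head[of i] only_head[of j] \<open>a < b\<close> by simp
qed

lemma eigenfunction_imp_char_poly_root:
  fixes z :: "'a \<Rightarrow> real"
  assumes "distinct vs" and "parcs G \<subseteq> set vs \<times> set vs"
    and nz: "\<exists>u\<in>set vs. z u \<noteq> 0"
    and eig: "\<And>u. u \<in> set vs \<Longrightarrow> sum z (parcs G `` {u}) = m * z u"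
  shows "m \<in># proots (char_poly (adjacency_matrix G vs))"
proof -
  define N where "N = length vs"
  define A :: "real mat" where "A = adjacency_matrix G vs"
  define v where "v = vec N (\<lambda>i. z (vs ! i))"
  have A: "A \<in> carrier_mat N N" by (simp add: A_def adjacency_matrix_def N_def)
  have "A *\<^sub>v v = m \<cdot>\<^sub>v v"
  proof (rule eq_vecI)
    fix i assume "i < dim_vec (m \<cdot>\<^sub>v v)"
    then have i: "i < N" by (simp add: v_def)
    have "vec_index (A *\<^sub>v v) i = (\<Sum>j<N. (if (vs ! i, vs ! j) \<in> parcs G then z (vs ! j) else 0))"
      using i A by (auto simp: scalar_prod_def A_def v_def adjacency_matrix_def N_def
          atLeast0LessThan intro!: sum.cong)
    also have "\<dots> = (\<Sum>u\<in>set vs. (if (vs ! i, u) \<in> parcs G then z u else 0))"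
      using sum.reindex_bij_betw[OF bij_betw_nth[OF assms(1) _ refl], of "{..<N}"
          "\<lambda>u. if (vs ! i, u) \<in> parcs G then z u else 0"] by (simp add: N_def)
    also have "\<dots> = sum z (parcs G `` {vs ! i})"
      by (rule sum.mono_neutral_cong_right) (use assms(2) in auto)
    also have "\<dots> = vec_index (m \<cdot>\<^sub>v v) i"
      using i eig[of "vs ! i"] by (simp add: v_def N_def)
    finally show "vec_index (A *\<^sub>v v) i = vec_index (m \<cdot>\<^sub>v v) i" .
  qed (use A in \<open>simp add: v_def\<close>)
  moreover have "v \<noteq> 0\<^sub>v N"
  proof
    assume "v = 0\<^sub>v N"
    then have "\<forall>i<N. z (vs ! i) = 0" by (metis v_def index_vec index_zero_vec(1))
    then show False using nz by (auto simp: in_set_conv_nth N_def)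
  qed
  moreover have "v \<in> carrier_vec N" by (simp add: v_def)
  ultimately have "eigenvalue A m"
    using A unfolding eigenvalue_def eigenvector_def by auto
  then have "poly (char_poly A) m = 0" using eigenvalue_root_char_poly[OF A] by simp
  moreover have "char_poly A \<noteq> 0" using degree_monic_char_poly[OF A] by auto
  ultimately show ?thesis by (simp add: A_def)
qed

context connected_regular_graph
begin

text \<open>
  The constant functions give the root \<open>k\<close>, the maximiser of the Rayleigh quotient a different
  and smaller root.
\<close>

lemma rayleigh_second_largest_eigenvalue:
  fixes y :: "'a \<Rightarrow> real"
  assumes "E = parcs G" and "distinct vs" and "set vs = V" and "2 \<le> card V" and "sum y V = 0"
  shows "(\<Sum>u\<in>V. y u * sum y (E `` {u})) \<le>
    second_largest_eigenvalue (adjacency_matrix G vs) * (\<Sum>u\<in>V. (y u)\<^sup>2)"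
proof -
  obtain m :: real and z :: "'a \<Rightarrow> real" where m: "m < k" and nz: "\<exists>u\<in>V. z u \<noteq> 0"
    and eig: "\<And>u. u \<in> V \<Longrightarrow> sum z (E `` {u}) = m * z u"
    and dom: "\<And>y. sum y V = 0 \<Longrightarrow> (\<Sum>u\<in>V. y u * sum y (E `` {u})) \<le> m * (\<Sum>u\<in>V. (y u)\<^sup>2)"
    by (rule ex_centred_eigenfunction_dominating[OF assms(4)]) (rule that)
  let ?roots = "proots (char_poly (adjacency_matrix G vs :: real mat))"
  have root: "m' \<in># ?roots"
    if "\<exists>u\<in>V. z' u \<noteq> 0" "\<And>u. u \<in> V \<Longrightarrow> sum z' (E `` {u}) = m' * z' u"
    for z' :: "'a \<Rightarrow> real" and m'
    by (rule eigenfunction_imp_char_poly_root[of vs G z'])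
      (use assms(1-3) that E_subset in auto)
  have "m \<in># ?roots" by (rule root[OF nz eig])
  moreover have "real k \<in># ?roots"
    by (rule root[of "\<lambda>_. 1"]) (use nz regular in auto)
  ultimately have "m \<le> second_largest_eigenvalue (adjacency_matrix G vs)"
    unfolding second_largest_eigenvalue_def by (rule second_largest_entry_ge) (rule m)
  then have "m * (\<Sum>u\<in>V. (y u)\<^sup>2) \<le>
      second_largest_eigenvalue (adjacency_matrix G vs) * (\<Sum>u\<in>V. (y u)\<^sup>2)"
    by (intro mult_right_mono sum_nonneg) auto
  with dom[OF assms(5)] show ?thesis by linarith
qed

text \<open>
  Let \<open>N\<close> be the adjacency block from \<open>W\<close> to \<open>U\<close>, \<open>b\<close> the indicator of \<open>X\<close> minus its mean, and \<open>p\<close> the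
  number of neighbours in \<open>X\<close>, so that \<open>N b\<close> is \<open>p\<close> minus its mean. The Rayleigh bound for the function
  that is \<open>b\<close> on \<open>W\<close> and \<open>N b / c\<close> on \<open>U\<close> yields \<open>|N b|\<^sup>2 \<le> c\<^sup>2 |b|\<^sup>2\<close>; the factor \<open>1/c\<close> is the one that
  makes this optimal. Adding back the means gives the claim.
\<close>

lemma expander_mixing_bipartite:
  fixes c :: real
  assumes UW: "U \<union> W = V" "U \<inter> W = {}" "E `` U \<subseteq> W" "E `` W \<subseteq> U"
    and card: "card U = n" "card W = n" "0 < n"
    and X: "X \<subseteq> W"
    and c: "0 < c"
    and rayleigh: "\<And>y :: 'a \<Rightarrow> real. sum y V = 0 \<Longrightarrow>
      (\<Sum>u\<in>V. y u * sum y (E `` {u})) \<le> c * (\<Sum>u\<in>V. (y u)\<^sup>2)"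
  shows "(\<Sum>u\<in>U. (real (card (E `` {u} \<inter> X)))\<^sup>2) \<le>
    c\<^sup>2 * (card X - (card X)\<^sup>2 / n) + (real k * card X)\<^sup>2 / n"
proof -
  have sub: "U \<subseteq> V" "W \<subseteq> V" using UW(1) by auto
  have fin: "finite U" "finite W" using sub finite_V by (auto intro: finite_subset)
  define s where "s = real (card X)"
  define p where "p u = real (card (E `` {u} \<inter> X))" for u
  define P where "P = (\<Sum>u\<in>U. (p u - k * s / n)\<^sup>2)"
  define ind where "ind w = (of_bool (w \<in> X) :: real)" for w
  define y where "y v = (if v \<in> W then ind v - s / n else (p v - k * s / n) / c)" for v
  have split: "sum f V = sum f U + sum f W" for f :: "'a \<Rightarrow> real"
    using sum.union_disjoint[OF fin UW(2), of f] UW(1) by simp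
  have yU: "y u = (p u - k * s / n) / c" if "u \<in> U" for u
    using that UW(2) by (auto simp: y_def)
  have indE: "sum ind (E `` {u}) = p u" for u
    using finite_nbrs[of u] by (simp add: ind_def p_def sum_of_bool_eq Int_def)
  have indW: "sum ind W = s"
    using fin(2) X by (simp add: ind_def s_def sum_of_bool_eq Int_absorb1 Collect_mem_eq)
  have pU: "sum p U = k * s"
    using sum_card_nbrs_Int[OF sub UW(3,4) X] by (simp add: p_def s_def)
  have yE: "sum y (E `` {u}) = p u - k * s / n" if "u \<in> U" for u
  proof -
    have "sum y (E `` {u}) = (\<Sum>w\<in>E `` {u}. ind w - s / n)"
      by (rule sum.cong) (use UW(3) that in \<open>auto simp: y_def\<close>)
    then show ?thesis using regular[of u] that sub by (auto simp: sum_subtractf indE)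
  qed
  have "sum y U = 0"
    using card by (simp add: yU pU sum_subtractf flip: sum_divide_distrib)
  moreover have "sum y W = 0"
    using card by (simp add: y_def indW sum_subtractf)
  ultimately have "sum y V = 0" by (simp add: split)
  note rayleigh[OF this]
  also have "(\<Sum>u\<in>V. y u * sum y (E `` {u})) = 2 * (\<Sum>u\<in>U. y u * sum y (E `` {u}))"
    using sum_nbrs_swap[OF sub UW(3,4), of y y] by (simp add: split)
  also have "(\<Sum>u\<in>U. y u * sum y (E `` {u})) = P / c"
    by (simp add: yU yE P_def power2_eq_square sum_divide_distrib)
  also have "(\<Sum>v\<in>V. (y v)\<^sup>2) = P / c\<^sup>2 + (s - s\<^sup>2 / n)"
  proof -
    have "(\<Sum>w\<in>W. (y w)\<^sup>2) = (\<Sum>w\<in>W. ind w - 2 * (s / n) * ind w + (s / n)\<^sup>2)"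
      by (rule sum.cong) (auto simp: y_def ind_def power2_eq_square algebra_simps)
    also have "\<dots> = s - 2 * (s / n) * s + n * (s / n)\<^sup>2"
      using card by (simp add: sum.distrib sum_subtractf indW flip: sum_distrib_left sum_divide_distrib)
    also have "\<dots> = s - s\<^sup>2 / n"
      using card by (simp add: power2_eq_square field_simps)
    finally show ?thesis by (simp add: split yU P_def power_divide sum_divide_distrib)
  qed
  also have "c * (P / c\<^sup>2 + (s - s\<^sup>2 / n)) = P / c + c * (s - s\<^sup>2 / n)"
    using c by (simp add: distrib_left power2_eq_square)
  finally have "P / c \<le> c * (s - s\<^sup>2 / n)" by simp
  then have "P \<le> c\<^sup>2 * (s - s\<^sup>2 / n)"
    by (simp add: pos_divide_le_eq[OF c] power2_eq_square mult.commute mult.left_commute)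
  moreover have "P = (\<Sum>u\<in>U. (p u)\<^sup>2) - (k * s)\<^sup>2 / n"
  proof -
    have "P = (\<Sum>u\<in>U. (p u)\<^sup>2 - 2 * (k * s / n) * p u + (k * s / n)\<^sup>2)"
      unfolding P_def by (rule sum.cong) (auto simp: power2_diff algebra_simps)
    also have "\<dots> = (\<Sum>u\<in>U. (p u)\<^sup>2) - 2 * (k * s / n) * (k * s) + n * (k * s / n)\<^sup>2"
      using card by (simp add: sum.distrib sum_subtractf pU flip: sum_distrib_left sum_divide_distrib)
    finally show ?thesis using card by (simp add: power2_eq_square field_simps)
  qed
  ultimately show ?thesis by (simp add: p_def s_def)
qed

end

section \<open>Sets that meet every neighbourhood evenly\<close>

locale connected_bipartite_cubic_graph = connected_regular_graph V E 3
  for V :: "'a set" and E +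
  fixes R C :: "'a set" and n :: nat
  assumes classes: "R \<union> C = V" "R \<inter> C = {}" "E `` R \<subseteq> C" "E `` C \<subseteq> R"
    and card_classes: "card R = n" "card C = n" "0 < n"
begin

context
  fixes S :: "'a set"
  assumes S: "S \<subseteq> C" "S \<noteq> {}"
    and even_S: "r \<in> R \<Longrightarrow> even (card (E `` {r} \<inter> S))"
begin

definition touched :: "'a set" where
  "touched = {r \<in> R. E `` {r} \<inter> S \<noteq> {}}"

lemma touched_subset: "touched \<subseteq> R"
  by (auto simp: touched_def)

lemma finite_classes: "finite R" "finite C" "finite S"
  using classes(1) S(1) finite_V by (auto intro: finite_subset)

lemma card_nbrs_S: "r \<in> R \<Longrightarrow> card (E `` {r} \<inter> S) = (if r \<in> touched then 2 else 0)"
proof -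
  assume r: "r \<in> R"
  have "card (E `` {r} \<inter> S) \<le> 3"
    using card_mono[OF finite_nbrs[of r], of "E `` {r} \<inter> S"] regular[of r] r classes(1) by auto
  moreover have "even (card (E `` {r} \<inter> S))" by (rule even_S[OF r])
  ultimately have "card (E `` {r} \<inter> S) \<in> {0, 2}"
    by (cases "card (E `` {r} \<inter> S) = 3") (auto elim!: evenE)
  then show ?thesis
    using r finite_nbrs[of r] by (auto simp: touched_def)
qed

lemma sum_over_R:
  fixes f :: "nat \<Rightarrow> real"
  assumes "f 0 = 0"
  shows "(\<Sum>r\<in>R. f (card (E `` {r} \<inter> S))) = card touched * f 2"
proof -
  have "(\<Sum>r\<in>R. f (card (E `` {r} \<inter> S))) = (\<Sum>r\<in>touched. f 2)"
  proof (rule sum.mono_neutral_cong_right)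
    show "f (card (E `` {r} \<inter> S)) = f 2" if "r \<in> touched" for r
      using that card_nbrs_S[of r] touched_subset by auto
  qed (use touched_subset finite_classes assms card_nbrs_S in auto)
  then show ?thesis by simp
qed

text \<open>
  Both sides count the edges at \<open>S\<close>.
\<close>

lemma card_touched: "2 * card touched = 3 * card S"
proof -
  have "(\<Sum>r\<in>R. real (card (E `` {r} \<inter> S))) = 3 * card S"
    using sum_card_nbrs_Int[of R C S] classes S(1) by auto
  then show ?thesis using sum_over_R[of real] by simp
qed

lemma card_S_pos: "0 < card S"
  using S finite_classes by (simp add: card_gt_0_iff)

text \<open>
  Tanner's bit-oriented bound: the square sum of \<open>card (E `` {r} \<inter> S)\<close> over \<open>R\<close> is \<open>6 card S\<close>,
  twice as large as the plain sum because the nonzero values are all 2.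
\<close>

lemma card_S_ge_two_fifths:
  assumes rayleigh: "\<And>y :: 'a \<Rightarrow> real. sum y V = 0 \<Longrightarrow>
      (\<Sum>u\<in>V. y u * sum y (E `` {u})) \<le> 2 * (\<Sum>u\<in>V. (y u)\<^sup>2)"
  shows "2 / 5 * real n \<le> card S"
proof -
  define d where "d = real (card S)"
  have "(\<Sum>r\<in>R. (real (card (E `` {r} \<inter> S)))\<^sup>2) = 6 * d"
    using sum_over_R[of "\<lambda>i. (real i)\<^sup>2"] card_touched by (simp add: d_def)
  then have "6 * d \<le> 4 * (d - d\<^sup>2 / n) + 9 * d\<^sup>2 / n"
    using expander_mixing_bipartite[OF classes card_classes S(1) _ rayleigh]
    by (simp add: d_def power_mult_distrib)
  then have "d * (2 * n) \<le> d * (5 * d)"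
    using card_classes(3) by (simp add: field_simps power2_eq_square)
  then show ?thesis using card_S_pos by (simp add: d_def)
qed

text \<open>
  Tanner's parity-oriented bound: the roles of the classes are exchanged, and the set whose neighbours
  are counted is \<open>touched\<close>. Elements of \<open>S\<close> contribute \<open>3\<^sup>2\<close> each to the square sum, and
  on \<open>C - S\<close> squares are bounded below by the counts themselves, which are integers.
\<close>

lemma card_S_ge_two_ninths:
  assumes rayleigh: "\<And>y :: 'a \<Rightarrow> real. sum y V = 0 \<Longrightarrow>
      (\<Sum>u\<in>V. y u * sum y (E `` {u})) \<le> sqrt 6 * (\<Sum>u\<in>V. (y u)\<^sup>2)"
  shows "2 / 9 * real n \<le> card S"
proof -
  define d where "d = real (card S)"
  define t where "t = real (card touched)"
  define q where "q u = real (card (E `` {u} \<inter> touched))" for u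
  have dt: "2 * t = 3 * d" using card_touched by (simp add: d_def t_def)
  have qS: "q u = 3" if "u \<in> S" for u
  proof -
    have "E `` {u} \<subseteq> touched"
      using that S(1) classes(4) sym_E by (auto simp: touched_def dest: symD)
    then show ?thesis
      using regular[of u] that S(1) classes(1) by (auto simp: q_def Int_absorb2)
  qed
  have split: "sum f C = sum f S + sum f (C - S)" for f :: "'a \<Rightarrow> real"
    using sum.subset_diff[OF S(1) finite_classes(2), of f] by simp
  have "sum q C = 3 * t" using sum_card_nbrs_Int[of C R touched] classes touched_subset by (auto simp: q_def t_def)
  then have "sum q (C - S) = 3 * t - 3 * d" by (simp add: split qS d_def)
  moreover have "q u \<le> (q u)\<^sup>2" for u
    by (simp add: q_def power2_eq_square flip: of_nat_mult)
  ultimately have "3 * t - 3 * d \<le> (\<Sum>u\<in>C - S. (q u)\<^sup>2)"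
    using sum_mono[of "C - S" q "\<lambda>u. (q u)\<^sup>2"] by simp
  then have "9 * d + (3 * t - 3 * d) \<le> (\<Sum>u\<in>C. (q u)\<^sup>2)"
    by (simp add: split qS d_def)
  also have "\<dots> \<le> 6 * (t - t\<^sup>2 / n) + 9 * t\<^sup>2 / n"
    using expander_mixing_bipartite[OF _ _ classes(4,3) card_classes(2,1,3) touched_subset _ rayleigh] classes
    by (simp add: q_def t_def power_mult_distrib Un_commute Int_commute)
  finally have "7 * t \<le> 6 * (t - t\<^sup>2 / n) + 9 * t\<^sup>2 / n" using dt by simp
  then have "t * n \<le> t * (3 * t)"
    using card_classes(3) by (simp add: field_simps power2_eq_square)
  moreover have "0 < t" using dt card_S_pos by (simp add: d_def)
  ultimately show ?thesis using dt by (simp add: d_def)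
qed

text \<open>
  A set of two elements met twice or not at all by every neighbourhood consists of twins.
\<close>

lemma card_S_ge_four:
  assumes no_twins: "\<And>u u'. u \<in> V \<Longrightarrow> u' \<in> V \<Longrightarrow> E `` {u} = E `` {u'} \<Longrightarrow> u = u'"
  shows "4 \<le> card S"
proof (rule ccontr)
  assume "\<not> ?thesis"
  moreover have "even (card S)"
    using card_touched by (metis dvd_triv_left even_mult_iff odd_numeral)
  ultimately have "card S = 2" using card_S_pos by (auto elim!: evenE)
  then obtain u u' where uu: "S = {u, u'}" "u \<noteq> u'" by (auto simp: card_2_iff)
  have sub: "E `` {v} \<subseteq> E `` {w}" if "v \<in> S" "w \<in> S" for v w
  proof
    fix r assume "r \<in> E `` {v}"
    then have r: "r \<in> R" "v \<in> E `` {r}"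
      using that S(1) classes(4) sym_E by (auto dest: symD)
    then have "card (E `` {r} \<inter> S) = card S"
      using card_nbrs_S[OF r(1)] that \<open>card S = 2\<close> by (auto simp: touched_def split: if_splits)
    then have "E `` {r} \<inter> S = S" using finite_classes by (intro card_subset_eq) auto
    then show "r \<in> E `` {w}" using that sym_E by (auto dest: symD)
  qed
  have "u = u'"
    by (rule no_twins) (use sub[of u u'] sub[of u' u] uu S(1) classes(1) in auto)
  with uu show False by simp
qed

end

end

section \<open>Arc-transitive cubic graphs have no twins\<close>

text \<open>
  Let \<open>u\<close>, \<open>u'\<close> be twins with neighbours \<open>M\<close>, and let \<open>x\<close> be the third neighbour of some \<open>a \<in> M\<close>. An
  automorphism fixing \<open>a\<close> and moving \<open>u\<close> to \<open>x\<close> provides a twin of \<open>x\<close>; it is a neighbour of \<open>a\<close>, hence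
  one of \<open>u\<close>, \<open>u'\<close>. So all three neighbours of \<open>a\<close> have neighbourhood \<open>M\<close>, and these at most six
  vertices are closed under taking neighbours.
\<close>

lemma (in connected_regular_graph) arc_transitive_cubic_no_twins:
  assumes "k = 3" and "6 < card V"
    and trans: "\<And>a u x. (a, u) \<in> E \<Longrightarrow> (a, x) \<in> E \<Longrightarrow>
      \<exists>f. inj_on f V \<and> f ` V \<subseteq> V \<and> (\<forall>p q. (p, q) \<in> E \<longrightarrow> (f p, f q) \<in> E) \<and> f a = a \<and> f u = x"
    and u: "u \<in> V" "u' \<in> V" "E `` {u} = E `` {u'}"
  shows "u = u'"
proof (rule ccontr)
  assume "u \<noteq> u'"
  define M where "M = E `` {u}"
  have card3: "card (E `` {v}) = 3" if "v \<in> V" for v using regular[OF that] \<open>k = 3\<close> by simp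
  have "card M = 3" using card3 u by (simp add: M_def)
  then obtain a where a: "a \<in> M" by fastforce
  have inV: "v \<in> V" "w \<in> V" if "(v, w) \<in> E" for v w using that E_subset by auto
  have sE: "(w, v) \<in> E" if "(v, w) \<in> E" for v w using that sym_E by (auto dest: symD)
  have "a \<in> V" using a inV by (auto simp: M_def)
  have au: "(a, u) \<in> E" "(a, u') \<in> E" using a u(3) sE by (auto simp: M_def)
  have same: "E `` {x} = M" if ax: "(a, x) \<in> E" for x
  proof (cases "x = u \<or> x = u'")
    case True
    then show ?thesis using u by (auto simp: M_def)
  next
    case False
    obtain f where f: "inj_on f V" "f ` V \<subseteq> V" "\<And>p q. (p, q) \<in> E \<Longrightarrow> (f p, f q) \<in> E"
      "f a = a" "f u = x" using trans[OF au(1) ax] by blast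
    have img: "f ` (E `` {v}) = E `` {f v}" if "v \<in> V" for v
    proof (rule card_subset_eq[OF finite_nbrs])
      show "f ` (E `` {v}) \<subseteq> E `` {f v}" using f(3) by auto
      have "inj_on f (E `` {v})" using f(1) inV by (auto intro: inj_on_subset)
      then show "card (f ` (E `` {v})) = card (E `` {f v})"
        using card3 that f(2) by (simp add: card_image image_subset_iff)
    qed
    have "E `` {f u'} = E `` {x}" using img[of u] img[of u'] u f(5) by simp
    moreover have "f u' \<noteq> x" using f(1,5) u \<open>u \<noteq> u'\<close> by (metis inj_onD)
    moreover have "(a, f u') \<in> E" using f(3)[OF au(2)] f(4) by simp
    moreover have "E `` {a} = {u, u', x}"
      using card3[OF \<open>a \<in> V\<close>] au ax \<open>u \<noteq> u'\<close> False finite_nbrs[of a]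
      by (intro card_seteq[symmetric]) auto
    ultimately have "f u' = u \<or> f u' = u'" by auto
    with \<open>E `` {f u'} = E `` {x}\<close> show ?thesis using u(3) by (auto simp only: M_def)
  qed
  define K where "K = M \<union> E `` {a}"
  have "E `` {b} = E `` {a}" if "b \<in> M" for b
  proof (rule card_subset_eq[symmetric, OF finite_nbrs])
    show "E `` {a} \<subseteq> E `` {b}" using same that sE by blast
    show "card (E `` {a}) = card (E `` {b})"
      using card3 \<open>a \<in> V\<close> that inV by (auto simp: M_def)
  qed
  then have "E `` K \<subseteq> K" using same by (auto simp: K_def)
  then have "K = V" using a inV by (intro closed_eq_V) (auto simp: K_def M_def)
  moreover have "card K \<le> 6"
    using card_Un_le[of M "E `` {a}"] \<open>card M = 3\<close> card3[OF \<open>a \<in> V\<close>] by (simp add: K_def)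
  ultimately show False using assms(2) by simp
qed

section \<open>From codewords to vertex sets\<close>

lemma of_nat_bit_eq_0_iff: "of_nat m = (0 :: bit) \<longleftrightarrow> even m"
  by (induction m) auto

text \<open>
  The difference of the parity checks \<open>i\<close> of \<open>x\<close> and \<open>y\<close> counts, modulo 2, the positions in the
  support of row \<open>i\<close> where the codewords differ.
\<close>

lemma codewords_differ_evenly:
  assumes H: "H \<in> carrier_mat m n"
    and entries: "\<And>j. j < n \<Longrightarrow> H $$ (i, j) \<in> {0, 1}"
    and "x \<in> parity_check_code H" and "y \<in> parity_check_code H" and i: "i < m"
  shows "even (card {j. j < n \<and> vec_index x j \<noteq> vec_index y j \<and> H $$ (i, j) = 1})"
proof -
  have zero: "(\<Sum>j<n. of_int (H $$ (i, j)) * vec_index x j) = 0"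
    if "x \<in> parity_check_code H" for x
  proof -
    have "vec_index (map_mat of_int H *\<^sub>v x) i = 0" and "dim_vec x = n"
      using that H i by (auto simp: parity_check_code_def mat_kernel_def)
    then show ?thesis using H i by (simp add: scalar_prod_def atLeast0LessThan)
  qed
  have "of_nat (card {j. j < n \<and> vec_index x j \<noteq> vec_index y j \<and> H $$ (i, j) = 1})
      = (\<Sum>j<n. of_bool (vec_index x j \<noteq> vec_index y j \<and> H $$ (i, j) = 1) :: bit)"
    by (simp add: sum_of_bool_eq) (rule arg_cong[of _ _ "\<lambda>A. of_nat (card A)"], auto)
  also have "\<dots> = (\<Sum>j<n. of_int (H $$ (i, j)) * vec_index x j - of_int (H $$ (i, j)) * vec_index y j)"
  proof (rule sum.cong[OF refl])
    fix j assume "j \<in> {..<n}"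
    then have "H $$ (i, j) = 0 \<or> H $$ (i, j) = 1" using entries by auto
    then show "of_bool (vec_index x j \<noteq> vec_index y j \<and> H $$ (i, j) = 1) =
        of_int (H $$ (i, j)) * vec_index x j - of_int (H $$ (i, j)) * vec_index y j"
      by (cases "vec_index x j = 0"; cases "vec_index y j = 0") auto
  qed
  also have "\<dots> = 0"
    unfolding sum_subtractf zero[OF assms(3)] zero[OF assms(4)] by simp
  finally show ?thesis by (simp add: of_nat_bit_eq_0_iff)
qed

lemma minimum_distance_attained:
  assumes C: "C \<subseteq> carrier_vec n" "0\<^sub>v n \<in> C" and "minimum_distance n C \<noteq> n"
  obtains x y where "x \<in> C" and "y \<in> C" and "x \<noteq> y"
    and "minimum_distance n C = hamming_distance x y"
proof -
  let ?D = "{hamming_distance x y | x y. x \<in> C \<and> y \<in> C \<and> x \<noteq> y}"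
  have ne: "C \<noteq> {0\<^sub>v n}" using assms(3) by (auto simp: minimum_distance_def)
  then obtain w where "w \<in> C" "w \<noteq> 0\<^sub>v n" using C(2) by blast
  then have "?D \<noteq> {}" using C(2) by blast
  moreover have "?D \<subseteq> {..n}"
  proof
    fix e assume "e \<in> ?D"
    then obtain x y where "x \<in> C" and e: "e = hamming_distance x y" by blast
    then have "dim_vec x = n" using C(1) by auto
    then have "e \<le> card {..<n}"
      unfolding e hamming_distance_def by (intro card_mono) auto
    then show "e \<in> {..n}" by simp
  qed
  then have "finite ?D" by (rule finite_subset) simp
  ultimately have "Min ?D \<in> ?D" by (intro Min_in)
  then show ?thesis using that ne by (auto simp: minimum_distance_def)
qed

lemma connected_imp_closed_eq_pverts:
  assumes "pair_graph G" and conn: "Digraph_Component.connected (with_proj G)"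
    and S: "S \<subseteq> pverts G" "S \<noteq> {}" "parcs G `` S \<subseteq> S"
  shows "S = pverts G"
proof
  interpret pair_graph G by fact
  show "pverts G \<subseteq> S"
  proof
    fix v assume v: "v \<in> pverts G"
    obtain s where s: "s \<in> S" using S(2) by auto
    have "s \<rightarrow>\<^sup>*\<^bsub>with_proj (mk_symmetric (with_proj G))\<^esub> v"
      using conn v s S(1) unfolding connected_def strongly_connected_def by auto
    then have "s \<rightarrow>\<^sup>*\<^bsub>with_proj G\<^esub> v" using reachable_mk_symmetric_eq[OF pair_sym_arcs] by simp
    then show "v \<in> S"
      by (induction rule: reachable_induct) (use s S(3) in auto)
  qed
qed fact

lemma out_degree_with_proj: "out_degree (with_proj G) v = card (parcs G `` {v})"
proof -
  have "out_arcs (with_proj G) v = Pair v ` (parcs G `` {v})"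
    by (auto simp: out_arcs_def)
  then show ?thesis by (simp add: out_degree_def card_image inj_on_def)
qed

lemma automorphism_vertex_map:
  assumes h: "automorphism G h"
  shows "inj_on (iso_verts h) (pverts G)" and "iso_verts h ` pverts G = pverts G"
    and "(p, q) \<in> parcs G \<Longrightarrow> (iso_verts h p, iso_verts h q) \<in> parcs G"
proof -
  have eq: "app_iso h (with_proj G) = with_proj G"
    using h by (simp add: automorphism_def)
  show "inj_on (iso_verts h) (pverts G)"
    using h by (simp add: automorphism_def pre_digraph.digraph_isomorphism_def)
  show "iso_verts h ` pverts G = pverts G"
    using arg_cong[OF eq, of verts] by simp
  assume "(p, q) \<in> parcs G"
  moreover have "iso_arcs h ` parcs G = parcs G"
    using arg_cong[OF eq, of arcs] by simp
  ultimately show "(iso_verts h p, iso_verts h q) \<in> parcs G"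
    using automorphism_iso_arcs[OF h] by (metis imageI)
qed

lemma adjacency_matrix_blocks:
  fixes H :: "int mat"
  assumes "length vs = 2 * n" and H: "H \<in> carrier_mat n n"
    and A: "adjacency_matrix G vs = four_block_mat (0\<^sub>m n n) H (transpose_mat H) (0\<^sub>m n n)"
    and ij: "i < n" "j < n"
  shows "(vs ! i, vs ! j) \<notin> parcs G" and "(vs ! (n + i), vs ! (n + j)) \<notin> parcs G"
    and "H $$ (i, j) = (if (vs ! i, vs ! (n + j)) \<in> parcs G then 1 else 0)"
proof -
  have entry: "(if (vs ! i, vs ! j) \<in> parcs G then 1 else 0) =
      four_block_mat (0\<^sub>m n n) H (transpose_mat H) (0\<^sub>m n n) $$ (i, j)"
    if "i < 2 * n" "j < 2 * n" for i j
    using that assms(1) unfolding A[symmetric] by (simp add: adjacency_matrix_def)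
  show "(vs ! i, vs ! j) \<notin> parcs G"
    using entry[of i j] ij H by (auto split: if_splits)
  show "(vs ! (n + i), vs ! (n + j)) \<notin> parcs G"
    using entry[of "n + i" "n + j"] ij H by (auto split: if_splits)
  show "H $$ (i, j) = (if (vs ! i, vs ! (n + j)) \<in> parcs G then 1 else 0)"
    using entry[of i "n + j"] ij H by simp
qed

section \<open>The minimum distance\<close>

theorem theorem7:
  fixes G :: "'a pair_pre_digraph" and n d :: nat and vs :: "'a list"
    and H :: "int mat" and lambda2 :: real
  assumes "n \<ge> 7"
    and "pair_graph G"
    and "card (pverts G) = 2 * n"
    and "Digraph_Component.connected (with_proj G)"
    and "bipartite G"
    and "cubic G"
    and "arc_transitive G"
    and "distinct vs" and "set vs = pverts G"
    and "H \<in> carrier_mat n n"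
    and "adjacency_matrix G vs = four_block_mat (0\<^sub>m n n) H (transpose_mat H) (0\<^sub>m n n)"
    and "lambda2 = second_largest_eigenvalue (adjacency_matrix G vs)"
    and "d = minimum_distance n (parity_check_code H)"
  shows "(lambda2 \<le> 2 \<longrightarrow> real d \<ge> 2 / 5 * real n) \<and>
         (2 < lambda2 \<and> lambda2 \<le> sqrt 6 \<longrightarrow> real d \<ge> 2 / 9 * real n) \<and>
         (sqrt 6 < lambda2 \<and> lambda2 < 3 \<longrightarrow> d \<ge> 4)"
proof (cases "d = n")
  \<comment> \<open>this includes the zero code\<close>
  case True
  then show ?thesis using assms(1) by simp
next
  case False
  interpret pair_graph G by fact
  define R where "R = (\<lambda>i. vs ! i) ` {..<n}"
  define C where "C = (\<lambda>j. vs ! (n + j)) ` {..<n}"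
  have len: "length vs = 2 * n" using assms(3,8,9) distinct_card by metis
  note blocks = adjacency_matrix_blocks[OF len assms(10,11)]
  have inj: "vs ! i = vs ! j \<longleftrightarrow> i = j" if "i < 2 * n" "j < 2 * n" for i j
    using that len assms(8) by (simp add: nth_eq_iff_index_eq)
  have verts: "pverts G = R \<union> C"
  proof -
    have "i \<in> (\<lambda>j. n + j) ` {..<n}" if "i < 2 * n" "\<not> i < n" for i
      by (rule image_eqI[of _ _ "i - n"]) (use that in auto)
    then have "{..<2 * n} = {..<n} \<union> (\<lambda>j. n + j) ` {..<n}"
      by auto
    then have "(!) vs ` {..<2 * n} = R \<union> C"
      by (simp add: R_def C_def image_Un image_image)
    moreover have "set vs = (!) vs ` {..<2 * n}" using len by (auto simp: set_conv_nth)
    ultimately show ?thesis using assms(9) by simp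
  qed
  have arcs_RC: "(u, v) \<in> parcs G \<Longrightarrow> u \<in> R \<and> v \<in> C \<or> u \<in> C \<and> v \<in> R" for u v
    using blocks(1,2) in_arcsD1[of u v] in_arcsD2[of u v] unfolding verts
    by (auto simp: R_def C_def)
  have disj: "R \<inter> C = {}" using inj by (auto simp: R_def C_def)
  interpret connected_bipartite_cubic_graph "pverts G" "parcs G" R C n
  proof
    show "finite (pverts G)" by (rule pair_finite_verts)
    show "card (parcs G `` {v}) = 3" if "v \<in> pverts G" for v
      using assms(6) that by (simp add: cubic_def flip: out_degree_with_proj)
    show "S = pverts G" if "S \<subseteq> pverts G" "S \<noteq> {}" "parcs G `` S \<subseteq> S" for S
      by (rule connected_imp_closed_eq_pverts) (use assms that in auto)
    show "parcs G \<subseteq> pverts G \<times> pverts G" by (auto dest: in_arcsD1 in_arcsD2)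
    show "sym (parcs G)" using pair_sym_arcs by (simp add: symmetric_def)
    show "card R = n" "card C = n"
      using inj by (auto simp: R_def C_def inj_on_def intro!: trans[OF card_image])
  qed (use assms(1) verts disj arcs_RC in auto)
  have "parity_check_code H \<subseteq> carrier_vec n" "0\<^sub>v n \<in> parity_check_code H"
    using assms(10) by (auto simp: parity_check_code_def mat_kernel_def)
  from minimum_distance_attained[OF this] False
  obtain x y where xy: "x \<in> parity_check_code H" "y \<in> parity_check_code H" "x \<noteq> y"
    "d = hamming_distance x y"
    unfolding assms(13) by metis
  have dims: "dim_vec x = n" "dim_vec y = n"
    using xy assms(10) by (auto simp: parity_check_code_def mat_kernel_def)
  define D where "D = {j. j < n \<and> vec_index x j \<noteq> vec_index y j}"
  define S where "S = (\<lambda>j. vs ! (n + j)) ` D"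
  have injD: "inj_on (\<lambda>j. vs ! (n + j)) A" if "A \<subseteq> {..<n}" for A
    using that inj by (auto simp: inj_on_def subset_iff)
  have "card S = card D"
    unfolding S_def by (rule card_image[OF injD]) (auto simp: D_def)
  then have "card S = d"
    by (simp add: xy(4) hamming_distance_def D_def dims)
  have "S \<noteq> {}"
    using xy(3) dims by (auto simp: S_def D_def)
  have "S \<subseteq> C" by (auto simp: S_def C_def D_def)
  have even: "even (card (parcs G `` {r} \<inter> S))" if "r \<in> R" for r
  proof -
    obtain i where i: "i < n" "r = vs ! i" using \<open>r \<in> R\<close> by (auto simp: R_def)
    let ?D = "{j. j < n \<and> vec_index x j \<noteq> vec_index y j \<and> H $$ (i, j) = 1}"
    have "parcs G `` {r} \<inter> S = (\<lambda>j. vs ! (n + j)) ` ?D"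
      using blocks(3)[OF i(1)] i(2) by (auto simp: S_def D_def split: if_splits)
    moreover have "card ((\<lambda>j. vs ! (n + j)) ` ?D) = card ?D"
      by (rule card_image[OF injD]) auto
    moreover have "even (card ?D)"
      by (rule codewords_differ_evenly[OF assms(10) _ xy(1,2) i(1)]) (simp add: blocks(3) i)
    ultimately show ?thesis by simp
  qed
  have rayleigh: "(\<Sum>u\<in>pverts G. f u * sum f (parcs G `` {u})) \<le> c * (\<Sum>u\<in>pverts G. (f u)\<^sup>2)"
    if "lambda2 \<le> c" "sum f (pverts G) = 0" for c and f :: "'a \<Rightarrow> real"
  proof -
    have "(\<Sum>u\<in>pverts G. f u * sum f (parcs G `` {u})) \<le> lambda2 * (\<Sum>u\<in>pverts G. (f u)\<^sup>2)"
      unfolding assms(12)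
      by (rule rayleigh_second_largest_eigenvalue) (use assms that in auto)
    also have "\<dots> \<le> c * (\<Sum>u\<in>pverts G. (f u)\<^sup>2)"
      using that(1) by (intro mult_right_mono sum_nonneg) auto
    finally show ?thesis .
  qed
  have no_twins: "u = u'"
    if "u \<in> pverts G" "u' \<in> pverts G" "parcs G `` {u} = parcs G `` {u'}" for u u'
  proof (rule arc_transitive_cubic_no_twins[OF refl _ _ that])
    show "6 < card (pverts G)" using assms(1,3) by simp
    fix a u x assume arcs: "(a, u) \<in> parcs G" "(a, x) \<in> parcs G"
    then obtain h where h: "automorphism G h" "iso_arcs h (a, u) = (a, x)"
      using assms(7) unfolding arc_transitive_def by metis
    then show "\<exists>f. inj_on f (pverts G) \<and> f ` pverts G \<subseteq> pverts G \<and>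
        (\<forall>p q. (p, q) \<in> parcs G \<longrightarrow> (f p, f q) \<in> parcs G) \<and> f a = a \<and> f u = x"
      using automorphism_vertex_map[OF h(1)] automorphism_iso_arcs[OF h(1) arcs(1)]
      by (intro exI[of _ "iso_verts h"]) auto
  qed
  note S = \<open>S \<subseteq> C\<close> \<open>S \<noteq> {}\<close> even
  show ?thesis
    using card_S_ge_two_fifths[OF S rayleigh] card_S_ge_two_ninths[OF S rayleigh]
      card_S_ge_four[OF S no_twins]
    unfolding \<open>card S = d\<close> by blast
qed

end
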